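(* Let $L>1$, let $\alpha_1,\dots,\alpha_G\in\mathbb R^2$ be pairwise distinct directions of the form $\alpha_g=(\cos\theta_g,\sin\theta_g)$ with $\theta_g\in[0,2\pi)$ and $0\le \theta_g<\theta_{g+1}$ for $g=1,\dots,G-1$, and let $0<h_1<\dots<h_L$. Then the atmospheric tomography operator $$\mathbf A:\prod_{l=1}^L L_2(\Omega_l)\to L_2(\Omega_T)^G,\qquad (\mathbf A\Phi)_g(\mathbf r)=\sum_{l=1}^L\Phi^{(l)}(\mathbf r+h_l\alpha_g),\quad \mathbf r\in\Omega_T,\ g=1,\dots,G,$$ is not uniquely invertible, i.e. there exist $\Phi\neq\tilde\Phi$ in $\prod_{l=1}^L L_2(\Omega_l)$ with $\mathbf A\Phi=\mathbf A\tilde\Phi$.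
   Context: $G\ge 1$ and $L$ are integers (number of guide stars and number of layers). The telescope aperture $\Omega_T=\{\mathbf r\in\mathbb R^2:\|\mathbf r\|\le T\}$ is the closed disc of radius $T>0$ centered at the origin. For $l=1,\dots,L$ and $g=1,\dots,G$, $\Omega_T(h_l\alpha_g)=\{\mathbf r\in\mathbb R^2:\mathbf r-h_l\alpha_g\in\Omega_T\}$ and $\Omega_l=\bigcup_{g=1}^G\Omega_T(h_l\alpha_g)$. Elements of $\prod_{l=1}^L L_2(\Omega_l)$ are written $\Phi=(\Phi^{(1)},\dots,\Phi^{(L)})$. Functions are real-valued and, as usual in $L_2$, identified if equal almost everywhere. *)

theory Defs
  imports "HOL-Analysis.Analysis"
begin

text \<open>Elements of \<open>L\<^sub>2(S)\<close> are handled through representatives: \<open>L2 S\<close> is the set of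
  square-integrable Lebesgue measurable functions on \<open>S\<close>, and the equality of the space
  \<open>L\<^sub>2(S)\<close> is \<open>L2_eq S\<close>, i.e. equality almost everywhere on \<open>S\<close>. Values outside \<open>S\<close> are
  irrelevant.\<close>

definition L2 :: "'a::euclidean_space set \<Rightarrow> ('a \<Rightarrow> real) set" where
  "L2 S = {f. f \<in> borel_measurable (lebesgue_on S) \<and>
              integrable (lebesgue_on S) (\<lambda>x. (f x)\<^sup>2)}"

definition L2_eq :: "'a::euclidean_space set \<Rightarrow> ('a \<Rightarrow> real) \<Rightarrow> ('a \<Rightarrow> real) \<Rightarrow> bool" where
  "L2_eq S f g \<longleftrightarrow> (AE x in lebesgue_on S. f x = g x)"

text \<open>The product \<open>\<Prod>\<^sub>i\<^sub>\<in>\<^sub>I L\<^sub>2(S i)\<close> and its equality; components outside \<open>I\<close> are irrelevant.\<close>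

definition L2_prod ::
    "nat set \<Rightarrow> (nat \<Rightarrow> 'a::euclidean_space set) \<Rightarrow> (nat \<Rightarrow> 'a \<Rightarrow> real) set" where
  "L2_prod I S = {F. \<forall>i\<in>I. F i \<in> L2 (S i)}"

definition L2_prod_eq ::
    "nat set \<Rightarrow> (nat \<Rightarrow> 'a::euclidean_space set) \<Rightarrow>
     (nat \<Rightarrow> 'a \<Rightarrow> real) \<Rightarrow> (nat \<Rightarrow> 'a \<Rightarrow> real) \<Rightarrow> bool" where
  "L2_prod_eq I S F F' \<longleftrightarrow> (\<forall>i\<in>I. L2_eq (S i) (F i) (F' i))"

definition aperture :: "real \<Rightarrow> (real^2) set" where
  "aperture T = {r. norm r \<le> T}"

definition shifted_aperture :: "real \<Rightarrow> real^2 \<Rightarrow> (real^2) set" where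
  "shifted_aperture T a = {r. r - a \<in> aperture T}"

text \<open>The layer domain \<open>\<Omega>\<^sub>l\<close>; guide stars and layers are indexed by \<open>{1..G}\<close> and \<open>{1..L}\<close>.\<close>

definition layer_domain ::
    "real \<Rightarrow> nat \<Rightarrow> (nat \<Rightarrow> real) \<Rightarrow> (nat \<Rightarrow> real^2) \<Rightarrow> nat \<Rightarrow> (real^2) set" where
  "layer_domain T G h \<alpha> l = (\<Union>g\<in>{1..G}. shifted_aperture T (h l *\<^sub>R \<alpha> g))"

definition tomography ::
    "nat \<Rightarrow> (nat \<Rightarrow> real) \<Rightarrow> (nat \<Rightarrow> real^2) \<Rightarrow> (nat \<Rightarrow> real^2 \<Rightarrow> real) \<Rightarrow> nat \<Rightarrow> real^2 \<Rightarrow> real" where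
  "tomography L h \<alpha> \<Phi> g r = (\<Sum>l\<in>{1..L}. \<Phi> l (r + h l *\<^sub>R \<alpha> g))"

subsection \<open>The operator is well defined on the product of the L2 spaces\<close>

lemma lebesgue_translation:
  fixes a :: "'a::euclidean_space"
  shows "(\<lambda>x. x + a) \<in> lebesgue \<rightarrow>\<^sub>M lebesgue" (is ?m)
    and "distr lebesgue lebesgue (\<lambda>x. x + a) = lebesgue" (is ?d)
proof -
  have eq: "(\<lambda>x. a + (\<Sum>j\<in>Basis. (1 * (x \<bullet> j)) *\<^sub>R j)) = (\<lambda>x. x + a)"
    by (simp add: euclidean_representation add.commute)
  show ?m
    using lebesgue_affine_measurable[of "\<lambda>_. 1" a] unfolding eq by simp
  have "lebesgue = density (distr lebesgue lebesgue (\<lambda>x. x + a)) (\<lambda>_. 1)"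
    using lebesgue_affine_euclidean[of "\<lambda>_. 1" a] unfolding eq by (simp add: one_ennreal_def)
  then show ?d by (simp add: density_1)
qed

lemma L2_translate:
  assumes f: "f \<in> L2 S" and S: "S \<in> sets lebesgue" and U: "U \<in> sets lebesgue"
    and sub: "\<And>r. r \<in> U \<Longrightarrow> r + a \<in> S"
  shows "(\<lambda>r. f (r + a)) \<in> L2 U"
proof -
  have m: "(\<lambda>r. r + a) \<in> lebesgue_on U \<rightarrow>\<^sub>M lebesgue_on S"
    using lebesgue_translation(1)[of a] sub
    by (intro measurable_restrict_space2 measurable_restrict_space1) auto
  have meas: "(\<lambda>r. f (r + a)) \<in> borel_measurable (lebesgue_on U)"
    using measurable_compose[OF m] f unfolding L2_def by blast
  let ?F = "\<lambda>x. indicator S x *\<^sub>R (f x)\<^sup>2"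
  have i: "integrable lebesgue ?F"
    using f S unfolding L2_def by (simp add: integrable_restrict_space)
  have "integrable lebesgue (\<lambda>r. ?F (r + a))"
    using i integrable_distr[OF lebesgue_translation(1)[of a], of ?F]
    by (simp add: lebesgue_translation(2))
  then have "integrable lebesgue (\<lambda>r. indicator U r *\<^sub>R ?F (r + a))"
    using U by (intro integrable_mult_indicator) auto
  moreover have "(\<lambda>r. indicator U r *\<^sub>R ?F (r + a)) = (\<lambda>r. indicator U r *\<^sub>R (f (r + a))\<^sup>2)"
    using sub by (auto simp: indicator_def)
  ultimately show ?thesis
    using meas U unfolding L2_def by (simp add: integrable_restrict_space)
qed

lemma L2_eq_translate:
  assumes eq: "L2_eq S f g" and S: "S \<in> sets lebesgue" and U: "U \<in> sets lebesgue"
    and sub: "\<And>r. r \<in> U \<Longrightarrow> r + a \<in> S"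
  shows "L2_eq U (\<lambda>r. f (r + a)) (\<lambda>r. g (r + a))"
proof -
  have "AE x in lebesgue. x \<in> S \<longrightarrow> f x = g x"
    using eq S unfolding L2_eq_def by (simp add: AE_restrict_space_iff)
  then have "AE x in distr lebesgue lebesgue (\<lambda>x. x + a). x \<in> S \<longrightarrow> f x = g x"
    unfolding lebesgue_translation(2) .
  then have "AE r in lebesgue. r + a \<in> S \<longrightarrow> f (r + a) = g (r + a)"
    by (rule AE_distrD[OF lebesgue_translation(1)])
  then have "AE r in lebesgue. r \<in> U \<longrightarrow> f (r + a) = g (r + a)"
    using sub by (auto elim: AE_mp)
  then show ?thesis
    using U unfolding L2_eq_def by (simp add: AE_restrict_space_iff)
qed

lemma L2_add:
  assumes "f \<in> L2 S" "g \<in> L2 S"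
  shows "(\<lambda>x. f x + g x) \<in> L2 S"
proof -
  have [measurable]: "f \<in> borel_measurable (lebesgue_on S)" "g \<in> borel_measurable (lebesgue_on S)"
    using assms unfolding L2_def by auto
  have "integrable (lebesgue_on S) (\<lambda>x. (f x + g x)\<^sup>2)"
  proof (rule Bochner_Integration.integrable_bound)
    show "integrable (lebesgue_on S) (\<lambda>x. 2 * (f x)\<^sup>2 + 2 * (g x)\<^sup>2)"
      using assms unfolding L2_def by auto
    have "(f x + g x)\<^sup>2 \<le> 2 * (f x)\<^sup>2 + 2 * (g x)\<^sup>2" for x
      using zero_le_power2[of "f x - g x"] by (simp add: power2_eq_square algebra_simps)
    then show "AE x in lebesgue_on S. norm ((f x + g x)\<^sup>2) \<le> norm (2 * (f x)\<^sup>2 + 2 * (g x)\<^sup>2)"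
      by simp
  qed measurable
  then show ?thesis unfolding L2_def by simp
qed

lemma L2_sum:
  assumes "finite I" "\<And>i. i \<in> I \<Longrightarrow> f i \<in> L2 S"
  shows "(\<lambda>x. \<Sum>i\<in>I. f i x) \<in> L2 S"
  using assms
proof (induction I rule: finite_induct)
  case empty
  then show ?case by (simp add: L2_def)
next
  case (insert i I)
  then show ?case by (simp add: L2_add)
qed

lemma aperture_lebesgue: "aperture T \<in> sets lebesgue"
proof -
  have "aperture T = cball 0 T" by (auto simp: aperture_def)
  then show ?thesis by simp
qed

lemma layer_domain_lebesgue: "layer_domain T G h \<alpha> l \<in> sets lebesgue"
proof -
  have "shifted_aperture T a = cball a T" for a
    by (auto simp: shifted_aperture_def aperture_def dist_norm norm_minus_commute)
  then show ?thesis unfolding layer_domain_def by (intro sets.finite_UN) auto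
qed

lemma aperture_shift_layer_domain:
  "g \<in> {1..G} \<Longrightarrow> r \<in> aperture T \<Longrightarrow> r + h l *\<^sub>R \<alpha> g \<in> layer_domain T G h \<alpha> l"
  unfolding layer_domain_def shifted_aperture_def by force

lemma tomography_L2_prod:
  assumes "\<Phi> \<in> L2_prod {1..L} (layer_domain T G h \<alpha>)"
  shows "tomography L h \<alpha> \<Phi> \<in> L2_prod {1..G} (\<lambda>_. aperture T)"
  using assms unfolding L2_prod_def tomography_def[abs_def]
  by (auto intro!: L2_sum
        L2_translate[OF _ layer_domain_lebesgue aperture_lebesgue aperture_shift_layer_domain])

lemma tomography_L2_prod_eq:
  assumes "L2_prod_eq {1..L} (layer_domain T G h \<alpha>) \<Phi> \<Phi>'"
  shows "L2_prod_eq {1..G} (\<lambda>_. aperture T) (tomography L h \<alpha> \<Phi>) (tomography L h \<alpha> \<Phi>')"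
  unfolding L2_prod_eq_def
proof
  fix g assume g: "g \<in> {1..G}"
  have "\<forall>l\<in>{1..L}. AE r in lebesgue_on (aperture T).
          \<Phi> l (r + h l *\<^sub>R \<alpha> g) = \<Phi>' l (r + h l *\<^sub>R \<alpha> g)"
    using assms L2_eq_translate[OF _ layer_domain_lebesgue aperture_lebesgue
        aperture_shift_layer_domain[OF g]]
    unfolding L2_prod_eq_def L2_eq_def by blast
  then have "AE r in lebesgue_on (aperture T). \<forall>l\<in>{1..L}.
          \<Phi> l (r + h l *\<^sub>R \<alpha> g) = \<Phi>' l (r + h l *\<^sub>R \<alpha> g)"
    by (simp add: AE_ball_countable)
  then show "L2_eq (aperture T) (tomography L h \<alpha> \<Phi> g) (tomography L h \<alpha> \<Phi>' g)"
    unfolding L2_eq_def tomography_def by eventually_elim (rule sum.cong, auto)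
qed

end

theory Submission
  imports Defs
begin

text \<open>A constant layer is unchanged by the shifts \<open>h l *\<^sub>R \<alpha> g\<close>, so
  the operator sends constants, one per layer, to their sum. With at least two layers, nonzero
  constants can sum to zero, which gives a nontrivial kernel element. Two facts make this rigorous
  in L2: the layer domains have finite measure, so constants are square-integrable
  (\<open>const_in_L2\<close>), and they contain a disc, so different constants are different
  elements (\<open>not_L2_eq_const\<close>).\<close>

text \<open>Opposite constants on the first two layers cancel along every line of sight.\<close>

lemma shifted_aperture_eq_cball: "shifted_aperture T a = cball a T"
  by (auto simp: shifted_aperture_def aperture_def dist_norm norm_minus_commute)

lemma layer_domain_lmeasurable: "layer_domain T G h \<alpha> l \<in> lmeasurable"
  unfolding layer_domain_def shifted_aperture_eq_cball
  by (intro fmeasurable.finite_UN) auto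

lemma const_in_L2:
  assumes "S \<in> lmeasurable"
  shows "(\<lambda>_. c) \<in> L2 S"
  using finite_measure.integrable_const[OF finite_measure_lebesgue_on[OF assms]]
  by (simp add: L2_def)

text \<open>Almost everywhere equality of two different constants would force \<open>S\<close> to be
  null, but the disc inside it has positive area.\<close>

lemma not_L2_eq_const:
  assumes "c \<noteq> d" "cball a T \<subseteq> S" "T > 0" "S \<in> sets lebesgue"
  shows "\<not> L2_eq S (\<lambda>_. c) (\<lambda>_. d)"
proof
  assume "L2_eq S (\<lambda>_. c) (\<lambda>_. d)"
  with assms have "AE x in lebesgue. x \<notin> S"
    unfolding L2_eq_def by (simp add: AE_restrict_space_iff)
  then have "S \<in> null_sets lebesgue"
    using assms by (simp add: AE_iff_null_sets)
  then have "negligible (cball a T)"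
    using assms negligible_iff_null_sets negligible_subset by blast
  then show False
    using negligible_imp_measure0 content_cball_pos[OF \<open>T > 0\<close>, of a] by force
qed

theorem proposition3p4:
  fixes G L :: nat and T :: real
    and \<theta> h :: "nat \<Rightarrow> real" and \<alpha> :: "nat \<Rightarrow> real^2"
  assumes "G \<ge> 1" and "L > 1" and "T > 0"
    and "\<forall>g\<in>{1..G}. \<theta> g \<in> {0..<2 * pi}"
    and "\<forall>g\<in>{1..<G}. 0 \<le> \<theta> g \<and> \<theta> g < \<theta> (g + 1)"
    and "\<forall>g\<in>{1..G}. \<alpha> g = vector [cos (\<theta> g), sin (\<theta> g)]"
    and "inj_on \<alpha> {1..G}"
    and "0 < h 1" and "\<forall>l\<in>{1..<L}. h l < h (l + 1)"
  shows "\<exists>\<Phi> \<in> L2_prod {1..L} (layer_domain T G h \<alpha>).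
         \<exists>\<Phi>' \<in> L2_prod {1..L} (layer_domain T G h \<alpha>).
           \<not> L2_prod_eq {1..L} (layer_domain T G h \<alpha>) \<Phi> \<Phi>' \<and>
           L2_prod_eq {1..G} (\<lambda>_. aperture T) (tomography L h \<alpha> \<Phi>) (tomography L h \<alpha> \<Phi>')"
proof -
  define \<Phi> :: "nat \<Rightarrow> real^2 \<Rightarrow> real" where
    "\<Phi> = (\<lambda>l _. if l = 1 then 1 else if l = 2 then - 1 else 0)"
  define \<Phi>' :: "nat \<Rightarrow> real^2 \<Rightarrow> real" where "\<Phi>' = (\<lambda>_ _. 0)"
  have in_L2: "\<Phi> \<in> L2_prod {1..L} (layer_domain T G h \<alpha>)"
    "\<Phi>' \<in> L2_prod {1..L} (layer_domain T G h \<alpha>)"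
    by (simp_all add: L2_prod_def \<Phi>_def \<Phi>'_def const_in_L2 layer_domain_lmeasurable)
  \<comment> \<open>Guide star 1 exists because \<open>G \<ge> 1\<close>; its shifted aperture is
    the disc needed to tell 1 from 0 on layer 1.\<close>
  have "cball (h 1 *\<^sub>R \<alpha> 1) T \<subseteq> layer_domain T G h \<alpha> 1"
    using \<open>G \<ge> 1\<close> unfolding layer_domain_def shifted_aperture_eq_cball by force
  then have "\<not> L2_eq (layer_domain T G h \<alpha> 1) (\<Phi> 1) (\<Phi>' 1)"
    using not_L2_eq_const[OF _ _ \<open>T > 0\<close> layer_domain_lebesgue, of 1 0]
    by (simp add: \<Phi>_def \<Phi>'_def)
  then have neq: "\<not> L2_prod_eq {1..L} (layer_domain T G h \<alpha>) \<Phi> \<Phi>'"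
    using \<open>L > 1\<close> unfolding L2_prod_eq_def by force
  \<comment> \<open>Only layers 1 and 2 contribute, with values 1 and -1. One common point
    \<open>r\<close> suffices although the line of sight meets each layer at a different point,
    since each \<open>\<Phi> l\<close> is constant.\<close>
  have "(\<Sum>l\<in>{1..L}. \<Phi> l r) = (\<Sum>l\<in>{1, 2}. \<Phi> l r)" for r
    using \<open>L > 1\<close> by (intro sum.mono_neutral_right) (auto simp: \<Phi>_def)
  then have "tomography L h \<alpha> \<Phi> = tomography L h \<alpha> \<Phi>'"
    by (simp add: tomography_def fun_eq_iff \<Phi>_def \<Phi>'_def)
  then have "L2_prod_eq {1..G} (\<lambda>_. aperture T) (tomography L h \<alpha> \<Phi>) (tomography L h \<alpha> \<Phi>')"
    by (simp add: L2_prod_eq_def L2_eq_def)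
  with in_L2 neq show ?thesis by blast
qed

end
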